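(* Let $0<x_1<x_2<\cdots$ be an infinite sequence of integers (trap positions on $\mathbb{Z}_{>0}$). If $\limsup\limits_{n\to\infty}\dfrac{x_{n+1}}{x_n^2}<1$, then the model with traps $(x_k)_{k\ge1}$ is non-critical.
   Context: The model is the trapped random walk on the half-line: with $D_+=\{x_k\}_{k\ge1}$, it is the Markov chain on $\{0,1,2,\dots\}\cup\{s\}$ where $s$ (the sink) and $0$ are absorbing, from $x\ge 1$ with $x\notin D_+$ the walk moves to $x-1$ or $x+1$ with probability $1/2$ each, and from $x\in D_+$ it moves to $x-1$, $x+1$ or $s$ with probability $1/3$ each. Let $T$ be the first time the walk is in $\{0,s\}$, and let $\mathbb{E}_x(T)\in[0,\infty]$ be its expectation for the walk started at $x$. The model is called critical if $\mathbb{E}_1(T)=\infty$ and non-critical if $\mathbb{E}_1(T)<\infty$ (the finiteness of $\mathbb{E}_x(T)$ does not depend on the starting point $x\ge 1$). *)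

theory Defs
  imports "HOL-Probability.Probability"
begin

datatype state = Site nat | Sink

instance state :: countable
  by countable_datatype

fun walk_step :: "nat set \<Rightarrow> state \<Rightarrow> state pmf" where
  "walk_step D Sink = return_pmf Sink"
| "walk_step D (Site 0) = return_pmf (Site 0)"
| "walk_step D (Site (Suc k)) =
     (if Suc k \<in> D then pmf_of_set {Site k, Site (Suc (Suc k)), Sink}
      else pmf_of_set {Site k, Site (Suc (Suc k))})"

(* The law of the walk started at z is the Ionescu-Tulcea measure on infinite paths:
   coordinate 0 is z, and coordinate i + 1 is drawn from the step distribution of coordinate i. *)
definition walk_kernel :: "nat set \<Rightarrow> state \<Rightarrow> nat \<Rightarrow> (nat \<Rightarrow> state) \<Rightarrow> state measure" where
  "walk_kernel D z i \<omega> =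
     measure_pmf (if i = 0 then return_pmf z else walk_step D (\<omega> (i - 1)))"

interpretation walk: Ionescu_Tulcea "walk_kernel D z" "\<lambda>_. count_space UNIV" for D z
proof (rule Ionescu_Tulcea.intro)
  fix i
  show "walk_kernel D z i \<in> measurable (PiM {0..<i} (\<lambda>_. count_space UNIV))
          (subprob_algebra (count_space UNIV))"
  proof (cases i)
    case 0
    then show ?thesis
      by (simp add: walk_kernel_def[abs_def] space_subprob_algebra measure_pmf_in_subprob_space)
  next
    case (Suc j)
    have "(\<lambda>\<omega>. measure_pmf (walk_step D (\<omega> j))) \<in> measurable
        (PiM {0..<i} (\<lambda>_. count_space UNIV)) (subprob_algebra (count_space UNIV))"
      by (rule measurable_compose[where N = "count_space UNIV"], rule measurable_component_singleton)
         (simp_all add: Suc space_subprob_algebra prob_space_imp_subprob_space prob_space_measure_pmf)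
    then show ?thesis
      by (simp add: walk_kernel_def[abs_def] Suc)
  qed
next
  fix i x
  show "prob_space (walk_kernel D z i x)"
    by (simp add: walk_kernel_def prob_space_measure_pmf)
qed

definition walk_law :: "nat set \<Rightarrow> state \<Rightarrow> (nat \<Rightarrow> state) measure" where
  "walk_law D z = walk.PF.lim D z"

definition absorption_time :: "(nat \<Rightarrow> state) \<Rightarrow> enat" where
  "absorption_time \<omega> = (INF n\<in>{n. \<omega> n \<in> {Site 0, Sink}}. enat n)"

definition expected_absorption_time :: "nat set \<Rightarrow> nat \<Rightarrow> ennreal" where
  "expected_absorption_time D x =
     (\<integral>\<^sup>+\<omega>. ennreal_of_enat (absorption_time \<omega>) \<partial>walk_law D (Site x))"

definition critical :: "nat set \<Rightarrow> bool" where
  "critical D \<longleftrightarrow> expected_absorption_time D 1 = \<infinity>"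

definition non_critical :: "nat set \<Rightarrow> bool" where
  "non_critical D \<longleftrightarrow> expected_absorption_time D 1 < \<infinity>"

lemma sets_walk_law [measurable_cong]:
  "sets (walk_law D z) = sets (PiM UNIV (\<lambda>_. count_space UNIV))"
  by (simp add: walk_law_def walk.PF.sets_lim)

lemma prob_space_walk_law: "prob_space (walk_law D z)"
proof
  have "space (PiM {} (\<lambda>_. count_space UNIV)) \<in> sets (PiM {} (\<lambda>_ :: nat. count_space (UNIV :: state set)))"
    by simp
  moreover have "(\<lambda>x. restrict x {}) -` {\<lambda>x. undefined} = (UNIV :: (nat \<Rightarrow> state) set)"
    by (auto simp: restrict_def)
  ultimately have "emeasure (walk_law D z) (space (walk_law D z)) = emeasure (walk.CI D z {}) (space (walk.CI D z {}))"
    using walk.lim[OF finite.emptyI, of "space (PiM {} (\<lambda>_. count_space UNIV))" D z]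
    by (simp add: walk_law_def prod_emb_def space_PiM walk.CI_def)
  also have "\<dots> = 1"
    by (rule prob_space.emeasure_space_1) (rule walk.PF.prob_space_P, simp_all)
  finally show "emeasure (walk_law D z) (space (walk_law D z)) = 1" .
qed

lemma measurable_absorption_time [measurable]:
  "absorption_time \<in> measurable (walk_law D z) (count_space UNIV)"
proof -
  have "absorption_time = (\<lambda>\<omega>. INF n. if \<omega> n \<in> {Site 0, Sink} then enat n else \<infinity>)"
  proof
    fix \<omega>
    show "absorption_time \<omega> = (INF n. if \<omega> n \<in> {Site 0, Sink} then enat n else \<infinity>)"
      unfolding absorption_time_def
      by (rule antisym; rule INF_greatest; (rule INF_lower2; force)?)
         (auto intro: INF_lower2)
  qed
  moreover have "(\<lambda>\<omega>. INF n. if \<omega> n \<in> {Site 0, Sink} then enat n else \<infinity>)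
      \<in> measurable (walk_law D z) (count_space UNIV)"
    by measurable
  ultimately show ?thesis
    by simp
qed

lemma emeasure_C_path:
  "emeasure (walk.C D z 0 (Suc n) u) {restrict p {0..<Suc n}} =
     (if p 0 = z then \<Prod>i<n. ennreal (pmf (walk_step D (p i)) (p (Suc i))) else 0)"
  if u: "u = (\<lambda>_. undefined)"
proof -
  have sgl: "{restrict p {0..<n}} \<in> sets (PiM {0..<n} (\<lambda>_. count_space (UNIV :: state set)))" for n
  proof -
    have "{restrict p {0..<n}} = PiE {0..<n} (\<lambda>i. {p i})"
      by (auto simp: PiE_iff extensional_def fun_eq_iff)
    then show ?thesis
      by (auto intro!: sets_PiM_I_finite)
  qed
  have u_space: "u \<in> space (PiM {0..<0} (\<lambda>_. count_space (UNIV :: state set)))"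
    by (simp add: u)
  have step: "emeasure (walk.C D z 0 (Suc n) u) {restrict p {0..<Suc n}} =
      emeasure (walk.C D z 0 n u) {restrict p {0..<n}} *
      ennreal (pmf (if n = 0 then return_pmf z else walk_step D (p (n - 1))) (p n))" for n
  proof -
    have eq: "emeasure (walk.eP D z n \<omega>) {restrict p {0..<Suc n}} =
        ennreal (pmf (if n = 0 then return_pmf z else walk_step D (p (n - 1))) (p n)) *
        indicator {restrict p {0..<n}} \<omega>"
      if "\<omega> \<in> space (walk.C D z 0 n u)" for \<omega>
    proof -
      have \<omega>: "\<omega> \<in> space (PiM {0..<n} (\<lambda>_. count_space UNIV))"
        using that walk.space_C[OF u_space, of D z n] by simp
      then have ext: "\<omega> \<in> extensional {0..<n}"
        by (simp add: space_PiM PiE_iff)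
      have upd: "fun_upd \<omega> n y = restrict p {0..<Suc n} \<longleftrightarrow> \<omega> = restrict p {0..<n} \<and> y = p n" for y
      proof (intro iffI conjI)
        assume a: "fun_upd \<omega> n y = restrict p {0..<Suc n}"
        have e: "fun_upd \<omega> n y i = restrict p {0..<Suc n} i" for i
          using a by simp
        show "y = p n" using e[of n] by simp
        show "\<omega> = restrict p {0..<n}"
        proof
          fix i
          show "\<omega> i = restrict p {0..<n} i"
            using e[of i] ext by (cases "i < n") (auto simp: extensional_def)
        qed
      next
        assume "\<omega> = restrict p {0..<n} \<and> y = p n"
        then show "fun_upd \<omega> n y = restrict p {0..<Suc n}"
          by (auto simp: fun_eq_iff)
      qed
      have "emeasure (walk.eP D z n \<omega>) {restrict p {0..<Suc n}} =
          emeasure (walk_kernel D z n \<omega>)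
            ((\<lambda>y. fun_upd \<omega> n y) -` {restrict p {0..<Suc n}} \<inter> space (count_space UNIV))"
        by (rule walk.emeasure_eP[OF \<omega> sgl])
      also have "(\<lambda>y. fun_upd \<omega> n y) -` {restrict p {0..<Suc n}} \<inter> space (count_space UNIV) =
          (if \<omega> = restrict p {0..<n} then {p n} else {})"
        using upd by auto
      also have "emeasure (walk_kernel D z n \<omega>) \<dots> =
          ennreal (pmf (if n = 0 then return_pmf z else walk_step D (p (n - 1))) (p n)) *
          indicator {restrict p {0..<n}} \<omega>"
        by (cases n) (auto simp: walk_kernel_def emeasure_pmf_single pmf_return indicator_def)
      finally show ?thesis .
    qed
    have "emeasure (walk.C D z 0 (Suc n) u) {restrict p {0..<Suc n}} =
        (\<integral>\<^sup>+\<omega>. emeasure (walk.eP D z n \<omega>) {restrict p {0..<Suc n}} \<partial>walk.C D z 0 n u)"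
      unfolding walk.C.simps add_0
    proof (rule emeasure_bind[OF _ _ sgl])
      show "space (walk.C D z 0 n u) \<noteq> {}"
        using walk.prob_space_C[OF u_space] by (rule prob_space.not_empty)
      show "walk.eP D z n \<in> measurable (walk.C D z 0 n u)
          (subprob_algebra (PiM {0..<Suc n} (\<lambda>_. count_space UNIV)))"
        using walk.measurable_eP[of D z n] walk.sets_C[OF u_space, of D z n]
        by (simp cong: measurable_cong_sets)
    qed
    also have "\<dots> = (\<integral>\<^sup>+\<omega>. ennreal (pmf (if n = 0 then return_pmf z else walk_step D (p (n - 1))) (p n)) *
        indicator {restrict p {0..<n}} \<omega> \<partial>walk.C D z 0 n u)"
      by (rule nn_integral_cong) (rule eq)
    also have "\<dots> = ennreal (pmf (if n = 0 then return_pmf z else walk_step D (p (n - 1))) (p n)) *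
        emeasure (walk.C D z 0 n u) {restrict p {0..<n}}"
      by (rule nn_integral_cmult_indicator)
         (use sgl[of n] walk.sets_C[OF u_space, of D z n] in simp)
    finally show ?thesis
      by (simp add: mult.commute)
  qed
  show ?thesis
  proof (induction n)
    case 0
    have "emeasure (walk.C D z 0 0 u) {restrict p {0..<0}} = 1"
      using emeasure_return[OF sgl[of 0], of u] by (simp add: u restrict_def)
    then show ?case
      by (subst step) (simp add: pmf_return indicator_def)
  next
    case (Suc n)
    show ?case
      unfolding step[of "Suc n"] Suc.IH by simp
  qed
qed

(* The finite-dimensional distributions, which determine walk_law D z. *)
lemma walk_law_cylinder:
  "emeasure (walk_law D z) {\<omega>. \<forall>i\<le>n. \<omega> i = p i} =
     (if p 0 = z then \<Prod>i<n. ennreal (pmf (walk_step D (p i)) (p (Suc i))) else 0)"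
proof -
  let ?M = "\<lambda>_ :: nat. count_space (UNIV :: state set)"
  let ?X = "{restrict p {0..<Suc n}}"
  have "?X = PiE {0..<Suc n} (\<lambda>i. {p i})"
    by (auto simp: PiE_iff extensional_def fun_eq_iff)
  then have X: "?X \<in> sets (PiM {0..<Suc n} ?M)"
    by (auto intro!: sets_PiM_I_finite)
  have "{\<omega>. \<forall>i\<le>n. \<omega> i = p i} = prod_emb UNIV ?M {0..<Suc n} ?X"
    by (auto simp: prod_emb_def space_PiM fun_eq_iff restrict_def less_Suc_eq_le) metis
  then have "emeasure (walk_law D z) {\<omega>. \<forall>i\<le>n. \<omega> i = p i} = emeasure (walk.CI D z {0..<Suc n}) ?X"
    unfolding walk_law_def using walk.lim[OF _ X, of D z] by simp
  also have "\<dots> = emeasure (walk.C D z 0 (Suc n) (\<lambda>_. undefined)) ?X"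
    using walk.emeasure_CI[OF _ X, of "Suc n" D z] sets.sets_into_space[OF X]
    by (simp add: prod_emb_id space_PiM del: walk.C.simps)
  also have "\<dots> = (if p 0 = z then \<Prod>i<n. ennreal (pmf (walk_step D (p i)) (p (Suc i))) else 0)"
    by (rule emeasure_C_path[OF refl])
  finally show ?thesis .
qed

end

theory Submission
  imports Defs
begin

text \<open>
  The expected absorption time is dominated by every nonnegative supersolution of the Poisson equation,
  that is every \<open>f\<close> with \<open>f 0 = 0\<close> and \<open>f x \<ge> 1 + (f (x - 1) + f (x + 1)) / 2\<close> off the traps
  and \<open>f x \<ge> 1 + (f (x - 1) + f (x + 1)) / 3\<close> on them. Keep only \<open>0\<close> and the traps from
  some index on, let \<open>q\<close> be the piecewise linear interpolation of \<open>y\<^sup>2\<close> at these points, and put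
  \<open>f x = (K + 1) q x - x\<^sup>2\<close>. Between consecutive points \<open>f\<close> has second difference \<open>-2\<close>. At
  \<open>x\<^sub>n\<close> the second difference of \<open>q\<close> is \<open>x\<^sub>n\<^sub>+\<^sub>1 - x\<^sub>n\<^sub>-\<^sub>1\<close>, so the
  inequality there is \<open>K x\<^sub>n\<^sup>2 \<ge> 1 + (K + 1) (x\<^sub>n\<^sub>+\<^sub>1 - x\<^sub>n\<^sub>-\<^sub>1)\<close>. If eventually
  \<open>x\<^sub>n\<^sub>+\<^sub>1 \<le> c x\<^sub>n\<^sup>2\<close> with \<open>c < 1\<close>, this holds for large \<open>n\<close> as soon as
  \<open>K > c / (1 - c)\<close>.
\<close>

section \<open>Finite-dimensional marginals and the one-step recursion of the walk law\<close>

text \<open>The projective limit agrees with the composed kernels on each initial block of times, so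
  integrals over a single coordinate can be computed in \<open>walk.C\<close>.\<close>

lemma distr_walk_law_restrict:
  "distr (walk_law D z) (PiM {0..<n} (\<lambda>_. count_space UNIV)) (\<lambda>\<omega>. restrict \<omega> {0..<n}) =
     walk.C D z 0 n (\<lambda>_. undefined)"
proof (rule measure_eqI)
  let ?M = "\<lambda>_ :: nat. count_space (UNIV :: state set)"
  have u: "(\<lambda>_. undefined) \<in> space (PiM {0..<0} ?M)"
    by simp
  show "sets (distr (walk_law D z) (PiM {0..<n} ?M) (\<lambda>\<omega>. restrict \<omega> {0..<n})) =
      sets (walk.C D z 0 n (\<lambda>_. undefined))"
    using walk.sets_C[OF u] by simp
  fix A assume "A \<in> sets (distr (walk_law D z) (PiM {0..<n} ?M) (\<lambda>\<omega>. restrict \<omega> {0..<n}))"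
  then have A: "A \<in> sets (PiM {0..<n} ?M)"
    by simp
  have "emeasure (distr (walk_law D z) (PiM {0..<n} ?M) (\<lambda>\<omega>. restrict \<omega> {0..<n})) A =
      emeasure (walk_law D z) (prod_emb UNIV ?M {0..<n} A)"
    by (rule emeasure_distr_restrict) (use A sets_walk_law in auto)
  also have "\<dots> = emeasure (walk.CI D z {0..<n}) A"
    unfolding walk_law_def by (rule walk.lim[OF _ A]) simp
  also have "\<dots> = emeasure (walk.C D z 0 n (\<lambda>_. undefined)) A"
    using walk.emeasure_CI[OF _ A, of n D z] sets.sets_into_space[OF A]
    by (simp add: prod_emb_id space_PiM)
  finally show "emeasure (distr (walk_law D z) (PiM {0..<n} ?M) (\<lambda>\<omega>. restrict \<omega> {0..<n})) A =
      emeasure (walk.C D z 0 n (\<lambda>_. undefined)) A" .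
qed

lemma nn_integral_walk_law_coordinate:
  fixes g :: "state \<Rightarrow> ennreal"
  assumes "k < n"
  shows "(\<integral>\<^sup>+\<omega>. g (\<omega> k) \<partial>walk_law D z) = (\<integral>\<^sup>+\<omega>. g (\<omega> k) \<partial>walk.C D z 0 n (\<lambda>_. undefined))"
proof -
  have k: "(\<lambda>\<omega>. g (\<omega> k)) \<in> borel_measurable (distr (walk_law D z)
      (PiM {0..<n} (\<lambda>_. count_space UNIV)) (\<lambda>\<omega>. restrict \<omega> {0..<n}))"
    unfolding measurable_distr_eq1
    by (rule measurable_compose[OF measurable_component_singleton]) (use assms in auto)
  have "(\<lambda>\<omega>. restrict \<omega> {0..<n}) \<in> measurable (walk_law D z) (PiM {0..<n} (\<lambda>_. count_space UNIV))"
    unfolding measurable_cong_sets[OF sets_walk_law refl] by (rule measurable_restrict_subset) simp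
  from nn_integral_distr[OF this k] show ?thesis
    using assms by (simp add: distr_walk_law_restrict)
qed

lemma nn_integral_walk_law_0:
  fixes g :: "state \<Rightarrow> ennreal"
  shows "(\<integral>\<^sup>+\<omega>. g (\<omega> 0) \<partial>walk_law D z) = g z"
proof -
  let ?M = "\<lambda>_ :: nat. count_space (UNIV :: state set)"
  have u: "(\<lambda>_. undefined) \<in> space (PiM {0..<0} ?M)"
    by simp
  have m: "(\<lambda>\<omega>. g (\<omega> 0)) \<in> borel_measurable (PiM {0..<Suc 0} ?M)"
    by (rule measurable_compose[OF measurable_component_singleton]) auto
  have "walk.C D z 0 (Suc 0) (\<lambda>_. undefined) = walk.eP D z 0 (\<lambda>_. undefined)"
    using bind_return[OF walk.measurable_eP u] by simp
  then show ?thesis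
    using walk.nn_integral_eP[OF u m]
    by (simp add: nn_integral_walk_law_coordinate[of 0 "Suc 0"] walk_kernel_def del: walk.C.simps)
qed

text \<open>The Markov property in integrated form, obtained by integrating out the last kernel of
  \<open>walk.C\<close>.\<close>

lemma nn_integral_walk_law_Suc:
  fixes g :: "state \<Rightarrow> ennreal"
  shows "(\<integral>\<^sup>+\<omega>. g (\<omega> (Suc n)) \<partial>walk_law D z) =
    (\<integral>\<^sup>+\<omega>. (\<integral>\<^sup>+t. g t \<partial>walk_step D (\<omega> n)) \<partial>walk_law D z)"
proof -
  let ?M = "\<lambda>_ :: nat. count_space (UNIV :: state set)" and ?u = "\<lambda>_ :: nat. undefined :: state"
  let ?C = "walk.C D z 0 (Suc n) ?u"
  have u: "?u \<in> space (PiM {0..<0} ?M)"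
    by simp
  have m: "(\<lambda>\<omega>. g (\<omega> (Suc n))) \<in> borel_measurable (PiM {0..<Suc (Suc n)} ?M)"
    by (rule measurable_compose[OF measurable_component_singleton]) auto
  have eP: "walk.eP D z (Suc n) \<in> measurable ?C (subprob_algebra (PiM {0..<Suc (Suc n)} ?M))"
    using walk.measurable_eP[of D z "Suc n"] walk.sets_C[OF u, of D z "Suc n"]
    by (simp cong: measurable_cong_sets del: walk.C.simps)
  have "(\<integral>\<^sup>+\<omega>. g (\<omega> (Suc n)) \<partial>walk_law D z) =
      (\<integral>\<^sup>+\<omega>. g (\<omega> (Suc n)) \<partial>walk.C D z 0 (Suc (Suc n)) ?u)"
    by (rule nn_integral_walk_law_coordinate) simp
  also have "\<dots> = (\<integral>\<^sup>+\<omega>. (\<integral>\<^sup>+\<omega>'. g (\<omega>' (Suc n)) \<partial>walk.eP D z (Suc n) \<omega>) \<partial>?C)"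
    unfolding walk.C.simps(2)[of D z 0 "Suc n"] add_0 by (rule nn_integral_bind[OF m eP])
  also have "\<dots> = (\<integral>\<^sup>+\<omega>. (\<integral>\<^sup>+t. g t \<partial>walk_step D (\<omega> n)) \<partial>?C)"
  proof (rule nn_integral_cong)
    fix \<omega> assume "\<omega> \<in> space ?C"
    then have "\<omega> \<in> space (PiM {0..<Suc n} ?M)"
      using walk.space_C[OF u, of D z "Suc n"] by (simp del: walk.C.simps)
    from walk.nn_integral_eP[OF this m]
    show "(\<integral>\<^sup>+\<omega>'. g (\<omega>' (Suc n)) \<partial>walk.eP D z (Suc n) \<omega>) =
        (\<integral>\<^sup>+t. g t \<partial>walk_step D (\<omega> n))"
      by (simp add: walk_kernel_def)
  qed
  also have "\<dots> = (\<integral>\<^sup>+\<omega>. (\<integral>\<^sup>+t. g t \<partial>walk_step D (\<omega> n)) \<partial>walk_law D z)"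
    by (rule nn_integral_walk_law_coordinate[symmetric]) simp
  finally show ?thesis .
qed

section \<open>Domination of the expected absorption time by supersolutions\<close>

text \<open>By \<open>F\<close>, each step lowers the expectation of \<open>F (\<omega> n)\<close>
  by at least the probability of being unabsorbed at time \<open>n\<close>. Telescoping bounds the
  partial sums of these probabilities by \<open>F (Site x)\<close>, and they dominate the partial
  sums of the tail series for the expected absorption time.\<close>

lemma expected_absorption_time_le_supersolution:
  fixes F :: "state \<Rightarrow> ennreal"
  assumes F: "\<And>s. indicator (- {Site 0, Sink}) s + (\<integral>\<^sup>+t. F t \<partial>walk_step D s) \<le> F s"
  shows "expected_absorption_time D x \<le> F (Site x)"
proof -
  let ?W = "walk_law D (Site x)" and ?a = "indicator (- {Site 0, Sink}) :: state \<Rightarrow> ennreal"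
  have coord: "(\<lambda>\<omega>. h (\<omega> n)) \<in> borel_measurable ?W" for h :: "state \<Rightarrow> ennreal" and n
    unfolding measurable_cong_sets[OF sets_walk_law refl]
    by (rule measurable_compose[OF measurable_component_singleton]) auto
  have partial: "(\<Sum>i<n. \<integral>\<^sup>+\<omega>. ?a (\<omega> i) \<partial>?W) + (\<integral>\<^sup>+\<omega>. F (\<omega> n) \<partial>?W) \<le> F (Site x)" for n
  proof (induction n)
    case 0
    then show ?case
      by (simp add: nn_integral_walk_law_0)
  next
    case (Suc n)
    have "(\<integral>\<^sup>+\<omega>. ?a (\<omega> n) \<partial>?W) + (\<integral>\<^sup>+\<omega>. F (\<omega> (Suc n)) \<partial>?W) =
        (\<integral>\<^sup>+\<omega>. ?a (\<omega> n) + (\<integral>\<^sup>+t. F t \<partial>walk_step D (\<omega> n)) \<partial>?W)"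
      unfolding nn_integral_walk_law_Suc by (rule nn_integral_add[symmetric]) (rule coord)+
    also have "\<dots> \<le> (\<integral>\<^sup>+\<omega>. F (\<omega> n) \<partial>?W)"
      by (rule nn_integral_mono) (rule F)
    finally have "(\<Sum>i<n. \<integral>\<^sup>+\<omega>. ?a (\<omega> i) \<partial>?W) +
        ((\<integral>\<^sup>+\<omega>. ?a (\<omega> n) \<partial>?W) + (\<integral>\<^sup>+\<omega>. F (\<omega> (Suc n)) \<partial>?W)) \<le> F (Site x)"
      using Suc.IH by (rule order_trans[OF add_left_mono])
    then show ?case
      by (simp add: add.assoc)
  qed
  have tail: "emeasure ?W {\<omega> \<in> space ?W. enat n < absorption_time \<omega>} \<le> (\<integral>\<^sup>+\<omega>. ?a (\<omega> n) \<partial>?W)" for n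
  proof -
    have "\<omega> n \<in> - {Site 0, Sink}" if "enat n < absorption_time \<omega>" for \<omega>
    proof
      assume "\<omega> n \<in> {Site 0, Sink}"
      then have "absorption_time \<omega> \<le> enat n"
        unfolding absorption_time_def by (intro INF_lower) simp
      with that show False
        by simp
    qed
    then have "(\<integral>\<^sup>+\<omega>. indicator {\<omega> \<in> space ?W. enat n < absorption_time \<omega>} \<omega> \<partial>?W) \<le>
        (\<integral>\<^sup>+\<omega>. ?a (\<omega> n) \<partial>?W)"
      by (intro nn_integral_mono) (auto split: split_indicator)
    then show ?thesis
      by (subst (asm) nn_integral_indicator) auto
  qed
  have "expected_absorption_time D x = (\<Sum>n. emeasure ?W {\<omega> \<in> space ?W. enat n < absorption_time \<omega>})"
    unfolding expected_absorption_time_def by (rule nn_integral_enat_function) simp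
  also have "\<dots> \<le> F (Site x)"
  proof (rule suminf_le_const)
    fix n
    have "(\<Sum>i<n. emeasure ?W {\<omega> \<in> space ?W. enat i < absorption_time \<omega>}) \<le>
        (\<Sum>i<n. \<integral>\<^sup>+\<omega>. ?a (\<omega> i) \<partial>?W)"
      by (rule sum_mono) (rule tail)
    also have "\<dots> \<le> F (Site x)"
      using partial[of n] by (rule order_trans[rotated]) simp
    finally show "(\<Sum>i<n. emeasure ?W {\<omega> \<in> space ?W. enat i < absorption_time \<omega>}) \<le> F (Site x)" .
  qed simp
  finally show ?thesis .
qed

lemma expected_absorption_time_le:
  fixes f :: "nat \<Rightarrow> real"
  assumes nonneg: "\<And>x. 0 \<le> f x" and "f 0 = 0"
    and free: "\<And>k. Suc k \<notin> D \<Longrightarrow> 2 + f k + f (Suc (Suc k)) \<le> 2 * f (Suc k)"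
    and trap: "\<And>k. Suc k \<in> D \<Longrightarrow> 3 + f k + f (Suc (Suc k)) \<le> 3 * f (Suc k)"
  shows "expected_absorption_time D x \<le> ennreal (f x)"
proof -
  \<comment> \<open>With value 0 at the sink, the average over the three moves from a trap is a
    third of the sum over the two neighbours.\<close>
  define F where "F s = (case s of Site y \<Rightarrow> ennreal (f y) | Sink \<Rightarrow> 0)" for s
  have "indicator (- {Site 0, Sink}) s + (\<integral>\<^sup>+t. F t \<partial>walk_step D s) \<le> F s" for s
  proof (cases "(D, s)" rule: walk_step.cases)
    case (3 D' k)
    then have s: "s = Site (Suc k)"
      by simp
    have sum: "(\<Sum>t\<in>{Site k, Site (Suc (Suc k))}. F t) = ennreal (f k + f (Suc (Suc k)))"
      "(\<Sum>t\<in>{Site k, Site (Suc (Suc k)), Sink}. F t) = ennreal (f k + f (Suc (Suc k)))"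
      by (simp_all add: F_def nonneg)
    show ?thesis
    proof (cases "Suc k \<in> D")
      case True
      then have "(\<integral>\<^sup>+t. F t \<partial>walk_step D s) = ennreal (f k + f (Suc (Suc k))) / 3"
        by (simp add: s nn_integral_pmf_of_set sum del: sum.insert)
      also have "\<dots> = ennreal ((f k + f (Suc (Suc k))) / 3)"
        by (simp add: divide_ennreal[symmetric] nonneg)
      finally have "indicator (- {Site 0, Sink}) s + (\<integral>\<^sup>+t. F t \<partial>walk_step D s) =
          ennreal (1 + (f k + f (Suc (Suc k))) / 3)"
        by (simp add: s nonneg)
      also have "\<dots> \<le> F s"
        unfolding s F_def state.case by (rule ennreal_leI) (use trap[OF True] in \<open>simp add: field_simps\<close>)
      finally show ?thesis .
    next
      case False
      then have "(\<integral>\<^sup>+t. F t \<partial>walk_step D s) = ennreal (f k + f (Suc (Suc k))) / 2"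
        by (simp add: s nn_integral_pmf_of_set sum del: sum.insert)
      also have "\<dots> = ennreal ((f k + f (Suc (Suc k))) / 2)"
        by (simp add: divide_ennreal[symmetric] nonneg)
      finally have "indicator (- {Site 0, Sink}) s + (\<integral>\<^sup>+t. F t \<partial>walk_step D s) =
          ennreal (1 + (f k + f (Suc (Suc k))) / 2)"
        by (simp add: s nonneg)
      also have "\<dots> \<le> F s"
        unfolding s F_def state.case by (rule ennreal_leI) (use free[OF False] in \<open>simp add: field_simps\<close>)
      finally show ?thesis .
    qed
  qed (simp_all add: F_def \<open>f 0 = 0\<close>)
  from expected_absorption_time_le_supersolution[of D F, OF this, of x] show ?thesis
    by (simp add: F_def)
qed

section \<open>The piecewise quadratic supersolution\<close>

lemma strict_mono_interval:
  fixes z :: "nat \<Rightarrow> nat"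
  assumes "strict_mono z" and "z 0 \<le> x"
  obtains n where "z n \<le> x" and "x < z (Suc n)"
proof -
  have "x < z (Suc x)"
    using strict_mono_imp_increasing[OF assms(1), of "Suc x"] by simp
  then have ex: "\<exists>n. x < z (Suc n)" ..
  define n where "n = (LEAST n. x < z (Suc n))"
  have "z n \<le> x"
  proof (cases n)
    case 0
    then show ?thesis
      using assms(2) by simp
  next
    case (Suc m)
    then have "\<not> x < z (Suc m)"
      using not_less_Least[of m "\<lambda>n. x < z (Suc n)"] by (simp add: n_def)
    then show ?thesis
      by (simp add: Suc)
  qed
  moreover have "x < z (Suc n)"
    unfolding n_def by (rule LeastI_ex[OF ex])
  ultimately show thesis
    by (rule that)
qed

text \<open>Here \<open>z\<close> lists 0 and the retained traps; \<open>D\<close> may contain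
  others. At \<open>z (Suc n)\<close> the supersolution equals \<open>K\<close> times the square of
  that point and has second difference \<open>(K + 1) * (z (Suc (Suc n)) - z n) - 2\<close>, so
  \<open>gap\<close> is exactly the trap inequality there.\<close>

lemma expected_absorption_time_finite:
  fixes z :: "nat \<Rightarrow> nat" and K :: real
  assumes z: "strict_mono z" and z0: "z 0 = 0" and traps: "range (z \<circ> Suc) \<subseteq> D"
    and K: "0 \<le> K"
    and gap: "\<And>n. 1 + (K + 1) * (real (z (Suc (Suc n))) - real (z n)) \<le> K * (real (z (Suc n)))\<^sup>2"
  shows "expected_absorption_time D x < \<infinity>"
proof -
  \<comment> \<open>The secant of the square function through \<open>z n\<close> and
    \<open>z (Suc n)\<close>: slope \<open>a + b\<close>, intercept \<open>- a * b\<close>.\<close>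
  define chord where "chord n y = real (z n + z (Suc n)) * y - real (z n * z (Suc n))" for n y
  define idx where "idx y = (SOME n. z n \<le> y \<and> y < z (Suc n))" for y
  define f where "f y = (K + 1) * chord (idx y) (real y) - (real y)\<^sup>2" for y
  have idx: "z (idx y) \<le> y \<and> y < z (Suc (idx y))" for y
    unfolding idx_def by (rule someI_ex) (metis strict_mono_interval[OF z] z0 le0)
  \<comment> \<open>\<open>idx\<close> uses half-open intervals, but consecutive chords agree at
    their common endpoint. The formula thus holds on the closed interval, as needed to evaluate
    \<open>f\<close> at both neighbours of a point.\<close>
  have f_eq: "f y = (K + 1) * chord n (real y) - (real y)\<^sup>2" if "z n \<le> y" "y \<le> z (Suc n)" for n y
  proof (cases "y = z (Suc n)")
    case True
    then have "idx y < Suc (Suc n)" "n < idx y"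
      using idx[of y] z by (auto simp: strict_mono_less strict_mono_less_eq dest!: leD)
    then have "idx y = Suc n"
      by simp
    then show ?thesis
      using True by (simp add: f_def chord_def algebra_simps)
  next
    case False
    then have "y < z (Suc n)"
      using that by simp
    then have "idx y < Suc n" "n < Suc (idx y)"
      using idx[of y] that(1) z le_less_trans by (metis strict_mono_less)+
    then have "idx y = n"
      by simp
    then show ?thesis
      by (simp add: f_def)
  qed
  have nonneg: "0 \<le> f y" for y
  proof -
    \<comment> \<open>Expanded, this says that the secant lies above the parabola between its
      endpoints; then \<open>f\<close> is \<open>K * chord\<close> plus a nonnegative
      difference.\<close>
    have "0 \<le> (real y - real (z (idx y))) * (real (z (Suc (idx y))) - real y)"
      using idx[of y] by simp
    then have "(real y)\<^sup>2 \<le> chord (idx y) (real y)"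
      by (simp add: chord_def algebra_simps power2_eq_square)
    moreover from this have "0 \<le> K * chord (idx y) (real y)"
      using K by (intro mult_nonneg_nonneg) (auto intro: order_trans[OF zero_le_power2])
    ultimately show ?thesis
      by (simp add: f_def algebra_simps)
  qed
  have "f 0 = 0"
    using f_eq[of 0 0] by (simp add: z0 chord_def)
  have free: "2 + f k + f (Suc (Suc k)) \<le> 2 * f (Suc k)" if "Suc k \<notin> range (z \<circ> Suc)" for k
  proof -
    let ?n = "idx (Suc k)"
    \<comment> \<open>The point is strictly inside its interval, so both neighbours lie on the same
      chord and only \<open>- y^2\<close> contributes to the second difference.\<close>
    have "z ?n \<noteq> Suc k"
      using that z0 by (cases ?n) (auto simp: image_iff dest: sym)
    then have "z ?n \<le> k" "Suc (Suc k) \<le> z (Suc ?n)"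
      using idx[of "Suc k"] by auto
    then have "f k + f (Suc (Suc k)) = 2 * f (Suc k) - 2"
      by (simp add: f_eq[of ?n] chord_def algebra_simps power2_eq_square)
    then show ?thesis
      by simp
  qed
  have trap: "3 + f k + f (Suc (Suc k)) \<le> 3 * f (Suc k)" if k: "Suc k \<in> range (z \<circ> Suc)" for k
  proof -
    obtain n where n: "z (Suc n) = Suc k"
      using k by auto
    have "z n < z (Suc n)" "z (Suc n) < z (Suc (Suc n))"
      using z by (simp_all add: strict_mono_Suc_iff)
    with n have "f k = (K + 1) * chord n (real k) - (real k)\<^sup>2"
      "f (Suc k) = (K + 1) * chord n (real (Suc k)) - (real (Suc k))\<^sup>2"
      "f (Suc (Suc k)) = (K + 1) * chord (Suc n) (real (Suc (Suc k))) - (real (Suc (Suc k)))\<^sup>2"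
      using f_eq[of n k] f_eq[of n "Suc k"] f_eq[of "Suc n" "Suc (Suc k)"] by simp_all
    \<comment> \<open>Both chords are expanded about the trap: one step left uses slope
      \<open>z n + Suc k\<close>, one step right uses
      \<open>Suc k + z (Suc (Suc n))\<close>.\<close>
    moreover have "chord n (real k) = (real (Suc k))\<^sup>2 - (real (z n) + real (Suc k))"
      "chord n (real (Suc k)) = (real (Suc k))\<^sup>2"
      "chord (Suc n) (real (Suc (Suc k))) =
         (real (Suc k))\<^sup>2 + (real (Suc k) + real (z (Suc (Suc n))))"
      by (simp_all add: chord_def n algebra_simps power2_eq_square)
    ultimately have "3 * f (Suc k) - f k - f (Suc (Suc k)) =
        K * (real (Suc k))\<^sup>2 - (K + 1) * (real (z (Suc (Suc n))) - real (z n)) + 2"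
      by (simp add: algebra_simps power2_eq_square)
    with gap[of n] show ?thesis
      by (simp add: n)
  qed
  have "expected_absorption_time D x \<le> ennreal (f x)"
  proof (rule expected_absorption_time_le)
    fix k
    show "2 + f k + f (Suc (Suc k)) \<le> 2 * f (Suc k)" if "Suc k \<notin> D"
      using free[of k] traps that by auto
    \<comment> \<open>At a trap of \<open>D\<close> outside \<open>z\<close>, the free inequality
      still holds. As \<open>f\<close> is nonnegative, it forces \<open>f (Suc k) \<ge> 1\<close>,
      and adding this gives the trap inequality.\<close>
    show "3 + f k + f (Suc (Suc k)) \<le> 3 * f (Suc k)" if "Suc k \<in> D"
      using free[of k] trap[of k] nonneg[of k] nonneg[of "Suc (Suc k)"] by argo
  qed (fact nonneg \<open>f 0 = 0\<close>)+
  then show ?thesis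
    by (rule le_less_trans) simp
qed

section \<open>From the limsup condition to the gap inequality\<close>

theorem theorem2p10:
  fixes x :: "nat \<Rightarrow> nat"
  assumes "0 < x 0"
    and "strict_mono x"
    and "limsup (\<lambda>n. ereal (real (x (Suc n)) / (real (x n))\<^sup>2)) < 1"
  shows "non_critical (range x)"
proof -
  have pos: "0 < x n" for n
    using assms(1) strict_mono_less_eq[OF assms(2), of 0 n] by simp
  obtain c where c1: "limsup (\<lambda>n. ereal (real (x (Suc n)) / (real (x n))\<^sup>2)) < ereal c" "ereal c < 1"
    using ereal_dense2[OF assms(3)] by blast
  have "eventually (\<lambda>n. ereal (real (x (Suc n)) / (real (x n))\<^sup>2) < ereal c) sequentially"
    by (rule Limsup_lessD[OF c1(1)])
  then obtain N where N: "\<And>n. N \<le> n \<Longrightarrow> real (x (Suc n)) / (real (x n))\<^sup>2 < c"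
    unfolding eventually_sequentially by auto
  then have ratio: "real (x (Suc n)) \<le> c * (real (x n))\<^sup>2" if "N \<le> n" for n
  proof -
    have "0 < (real (x n))\<^sup>2"
      using pos[of n] by simp
    moreover have "real (x (Suc n)) / (real (x n))\<^sup>2 < c"
      by (rule N[OF that])
    ultimately show ?thesis
      by (simp add: pos_divide_less_eq less_imp_le)
  qed
  have "c < 1"
    using c1(2) by simp
  have "0 \<le> c"
  proof -
    have "0 \<le> c * (real (x N))\<^sup>2"
      using ratio[of N] by linarith
    with pos[of N] show ?thesis
      by (simp add: zero_le_mult_iff)
  qed
  \<comment> \<open>The summand 1 exceeds the threshold \<open>c / (1 - c)\<close> so that the
    margin \<open>K - (K + 1) * c\<close> is the positive number \<open>1 - c\<close>.\<close>
  define K where "K = c / (1 - c) + 1"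
  have "0 \<le> K" and K: "K - (K + 1) * c = 1 - c"
    using \<open>0 \<le> c\<close> \<open>c < 1\<close> by (simp_all add: K_def field_simps)
  \<comment> \<open>\<open>M\<close> makes the margin \<open>(1 - c) * (x (L + n))^2\<close> at
    least 1, because \<open>x (L + n) \<ge> L + n \<ge> M\<close>; \<open>N\<close> provides the
    ratio bound.\<close>
  obtain M where M: "1 / (1 - c) \<le> real M"
    using real_arch_simple by blast
  define L where "L = max M N"
  define z where "z n = (case n of 0 \<Rightarrow> 0 | Suc m \<Rightarrow> x (L + m))" for n
  have "expected_absorption_time (range x) 1 < \<infinity>"
  proof (rule expected_absorption_time_finite[where z = z and K = K])
    show "strict_mono z"
      using pos assms(2) by (auto simp: strict_mono_Suc_iff z_def split: nat.split)
    fix n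
    have "M \<le> x (L + n)"
      using strict_mono_imp_increasing[OF assms(2), of "L + n"] by (simp add: L_def)
    also have "\<dots> \<le> (x (L + n))\<^sup>2"
      by (simp add: power2_eq_square)
    finally have "1 / (1 - c) \<le> real ((x (L + n))\<^sup>2)"
      using M by linarith
    then have large: "1 \<le> (1 - c) * (real (x (L + n)))\<^sup>2"
      using \<open>c < 1\<close> by (simp add: field_simps)
    \<comment> \<open>The subtracted \<open>z n\<close> is simply dropped, since the ratio bound on
      the next trap alone leaves enough margin.\<close>
    have "(K + 1) * (real (z (Suc (Suc n))) - real (z n)) \<le> (K + 1) * real (x (Suc (L + n)))"
      using \<open>0 \<le> K\<close> by (intro mult_left_mono) (simp_all add: z_def)
    also have "\<dots> \<le> (K + 1) * (c * (real (x (L + n)))\<^sup>2)"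
      using \<open>0 \<le> K\<close> by (intro mult_left_mono ratio) (simp_all add: L_def)
    also have "\<dots> = K * (real (x (L + n)))\<^sup>2 - (K - (K + 1) * c) * (real (x (L + n)))\<^sup>2"
      by (simp add: algebra_simps)
    finally show "1 + (K + 1) * (real (z (Suc (Suc n))) - real (z n)) \<le> K * (real (z (Suc n)))\<^sup>2"
      using large unfolding K by (simp add: z_def)
  qed (auto simp: z_def \<open>0 \<le> K\<close>)
  then show ?thesis
    by (simp add: non_critical_def)
qed

end
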